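(* Let $m,n\ge 2$ and $\varphi\in\Phi_m$. Then Orlicz addition is an operation $+_{\varphi}:\left(\mathcal{K}^n_o\right)^m\to\mathcal{K}^n_o$ with the following properties. (Monotonicity) If $K_j\subset L_j$ with $K_j,L_j\in\mathcal{K}^n_o$, $j=1,\dots,m$, then $+_\varphi(K_1,\dots,K_m)\subset +_\varphi(L_1,\dots,L_m)$. (Continuity) If $K_{ij}\in\mathcal{K}^n_o$ for $i\in\mathbb{N}\cup\{0\}$, $j=1,\dots,m$, and $K_{ij}\to K_{0j}$ in the Hausdorff metric as $i\to\infty$ for each $j$, then $+_\varphi(K_{i1},\dots,K_{im})\to +_\varphi(K_{01},\dots,K_{0m})$ in the Hausdorff metric as $i\to\infty$. ($GL(n)$ covariance) $A\left(+_\varphi(K_1,\dots,K_m)\right)=+_\varphi(AK_1,\dots,AK_m)$ for all $A\in GL(n)$ and $K_1,\dots,K_m\in\mathcal{K}^n_o$. (Projection covariance) $\left(+_\varphi(K_1,\dots,K_m)\right)|S=+_\varphi(K_1|S,\dots,K_m|S)$ for every linear subspace $S$ of $\mathbb{R}^n$ and all $K_1,\dots,K_m\in\mathcal{K}^n_o$. (Identity) $+_\varphi(\{o\},\dots,\{o\},K_j,\{o\},\dots,\{o\})=K_j$ for all $K_j\in\mathcal{K}^n_o$ (in the $j$th position), $j=1,\dots,m$. Moreover, $+_\varphi$ maps $\left(\mathcal{K}^n_s\right)^m$ into $\mathcal{K}^n_s$.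
   Context: $\mathcal{K}^n_o$ is the class of compact convex subsets of $\mathbb{R}^n$ containing the origin $o$; $\mathcal{K}^n_s$ is the class of nonempty compact convex sets $K$ in $\mathbb{R}^n$ with $K=-K$. The support function of $K$ is $h_K(x)=\sup\{x\cdot y:y\in K\}$, $x\in\mathbb{R}^n$. $X|S$ denotes the orthogonal projection of $X$ on the linear subspace $S$. $\Phi_m$ is the set of convex functions $\varphi:[0,\infty)^m\to[0,\infty)$ that are increasing (i.e. nondecreasing) in each variable and satisfy $\varphi(o)=0$ and $\varphi(e_j)=1$, $j=1,\dots,m$, where $e_1,\dots,e_m$ is the standard basis. For $\varphi\in\Phi_m$ and $K_1,\dots,K_m\in\mathcal{K}^n_o$, the Orlicz sum $+_\varphi(K_1,\dots,K_m)$ is the compact convex set with support function $$h_{+_\varphi(K_1,\dots,K_m)}(x)=\inf\left\{\lambda>0:\varphi\left(\frac{h_{K_1}(x)}{\lambda},\dots,\frac{h_{K_m}(x)}{\lambda}\right)\le 1\right\},\quad x\in\mathbb{R}^n.$$ *)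

theory Defs
  imports "HOL-Analysis.Analysis"
begin

text \<open>
  The numbers \<open>n\<close> and \<open>m\<close> are the cardinalities of the finite index types
  \<open>'n\<close> and \<open>'m\<close>; an \<open>m\<close>-tuple of sets is a function on \<open>'m\<close>.
\<close>

definition convex_bodies_o :: "(real ^ 'n) set set" where
  "convex_bodies_o = {K. compact K \<and> convex K \<and> 0 \<in> K}"

definition convex_bodies_s :: "(real ^ 'n) set set" where
  "convex_bodies_s = {K. K \<noteq> {} \<and> compact K \<and> convex K \<and> K = uminus ` K}"

text \<open>Only meaningful for nonempty bounded sets.\<close>

definition support_fun :: "(real ^ 'n) set \<Rightarrow> real ^ 'n \<Rightarrow> real" where
  "support_fun K x = (SUP y\<in>K. x \<bullet> y)"

text \<open>Only meaningful for nonempty bounded sets.\<close>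

definition hausdorff_dist :: "(real ^ 'n) set \<Rightarrow> (real ^ 'n) set \<Rightarrow> real" where
  "hausdorff_dist K L = max (SUP x\<in>K. infdist x L) (SUP y\<in>L. infdist y K)"

definition orth_proj :: "(real ^ 'n) set \<Rightarrow> real ^ 'n \<Rightarrow> real ^ 'n" where
  "orth_proj S x = (THE y. y \<in> S \<and> x - y \<in> S\<^sup>\<bottom>)"

definition orthant :: "(real ^ 'm) set" where
  "orthant = {x. \<forall>j. 0 \<le> x $ j}"

text \<open>
  Members are functions on the whole space of which only the restriction to the orthant matters.
\<close>

definition Orlicz_Phi :: "(real ^ 'm \<Rightarrow> real) set" where
  "Orlicz_Phi = {\<phi>.
     (\<forall>x\<in>orthant. 0 \<le> \<phi> x) \<and>
     convex_on orthant \<phi> \<and>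
     (\<forall>j. \<forall>x\<in>orthant. \<forall>y\<in>orthant.
        (\<forall>i. i \<noteq> j \<longrightarrow> x $ i = y $ i) \<and> x $ j \<le> y $ j \<longrightarrow> \<phi> x \<le> \<phi> y) \<and>
     \<phi> 0 = 0 \<and>
     (\<forall>j. \<phi> (axis j 1) = 1)}"

definition orlicz_support ::
    "(real ^ 'm \<Rightarrow> real) \<Rightarrow> ('m \<Rightarrow> (real ^ 'n) set) \<Rightarrow> real ^ 'n \<Rightarrow> real" where
  "orlicz_support \<phi> K x = Inf {l. 0 < l \<and> \<phi> (\<chi> j. support_fun (K j) x / l) \<le> 1}"

text \<open>
  Nonemptiness is demanded explicitly because \<^const>\<open>support_fun\<close> has an unspecified value on
  the empty set.
\<close>

definition is_orlicz_sum ::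
    "(real ^ 'm \<Rightarrow> real) \<Rightarrow> ('m \<Rightarrow> (real ^ 'n) set) \<Rightarrow> (real ^ 'n) set \<Rightarrow> bool" where
  "is_orlicz_sum \<phi> K L \<longleftrightarrow>
     L \<noteq> {} \<and> compact L \<and> convex L \<and> (\<forall>x. support_fun L x = orlicz_support \<phi> K x)"

definition orlicz_sum ::
    "(real ^ 'm \<Rightarrow> real) \<Rightarrow> ('m \<Rightarrow> (real ^ 'n) set) \<Rightarrow> (real ^ 'n) set" where
  "orlicz_sum \<phi> K = (THE L. is_orlicz_sum \<phi> K L)"

end

theory Submission
  imports Defs
begin

text \<open>
  On the orthant, \<open>N h = inf {l > 0. \<phi> (h / l) \<le> 1}\<close> is the gauge of the convex, downward
  closed set \<open>{\<phi> \<le> 1}\<close>; it is therefore monotone and sublinear, and \<open>N (t e\<^sub>j) = t\<close>.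
  Monotonicity and subadditivity give \<open>\<bar>N h - N k\<bar> \<le> \<Sum>\<^sub>j \<bar>h\<^sub>j - k\<^sub>j\<bar>\<close>, so no continuity of \<open>\<phi>\<close>
  has to be established. Composing \<open>N\<close> with the support functions of the \<open>K\<^sub>j\<close> yields a sublinear
  function, hence the support function of a unique compact convex set. All the asserted properties are
  then read off support functions: inclusion is pointwise order, the Hausdorff distance is the
  supremum distance on the unit sphere, and a linear map acts by composition with its adjoint.
\<close>

section \<open>Support functions\<close>

lemma support_fun_upper:
  assumes "bounded K" "y \<in> K"
  shows "x \<bullet> y \<le> support_fun K x"
proof -
  obtain B where B: "\<And>z. z \<in> K \<Longrightarrow> norm z \<le> B"
    using assms(1) bounded_iff by blast
  have "x \<bullet> z \<le> norm x * B" if "z \<in> K" for z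
    using norm_cauchy_schwarz[of x z] mult_left_mono[OF B[OF that] norm_ge_zero[of x]] by linarith
  then have "bdd_above ((\<bullet>) x ` K)"
    by (intro bdd_aboveI[of _ "norm x * B"]) auto
  then show ?thesis
    unfolding support_fun_def using assms(2) by (intro cSUP_upper)
qed

lemma support_fun_least:
  assumes "K \<noteq> {}" "\<And>y. y \<in> K \<Longrightarrow> x \<bullet> y \<le> b"
  shows "support_fun K x \<le> b"
  unfolding support_fun_def using assms by (intro cSUP_least)

lemma support_fun_nonneg:
  assumes "bounded K" "0 \<in> K"
  shows "0 \<le> support_fun K x"
  using support_fun_upper[OF assms, of x] by simp

lemma support_fun_mono:
  assumes "bounded L" "K \<noteq> {}" "K \<subseteq> L"
  shows "support_fun K x \<le> support_fun L x"
  using assms by (intro support_fun_least support_fun_upper) auto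

lemma support_fun_add:
  assumes "bounded K" "K \<noteq> {}"
  shows "support_fun K (x + y) \<le> support_fun K x + support_fun K y"
proof (rule support_fun_least[OF assms(2)])
  fix z assume "z \<in> K"
  then show "(x + y) \<bullet> z \<le> support_fun K x + support_fun K y"
    using support_fun_upper[OF assms(1), of z x] support_fun_upper[OF assms(1), of z y]
    by (simp add: inner_add_left)
qed

lemma support_fun_scaleR:
  assumes "bounded K" "K \<noteq> {}" "0 \<le> t"
  shows "support_fun K (t *\<^sub>R x) = t * support_fun K x"
proof (cases "t = 0")
  case True
  then show ?thesis using assms(2) by (simp add: support_fun_def)
next
  case False
  then have t: "t > 0" using assms(3) by simp
  \<comment> \<open>One inequality, for every positive factor, suffices: used again with
    \<open>inverse t\<close> at the point \<open>t *\<^sub>R x\<close> it becomes the reverse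
    one.\<close>
  have le: "support_fun K (s *\<^sub>R w) \<le> s * support_fun K w" if "s > 0" for s w
    using that support_fun_upper[OF assms(1), of _ w]
    by (intro support_fun_least[OF assms(2)]) (auto intro: mult_left_mono)
  have "support_fun K x \<le> inverse t * support_fun K (t *\<^sub>R x)"
    using le[of "inverse t" "t *\<^sub>R x"] t by simp
  then show ?thesis
    using le[OF t, of x] t by (simp add: field_simps)
qed

lemma support_fun_singleton_zero: "support_fun {0} x = 0"
  by (simp add: support_fun_def)

lemma support_fun_linear_image:
  assumes "linear f"
  shows "support_fun (f ` K) x = support_fun K (adjoint f x)"
  unfolding support_fun_def by (simp add: image_image adjoint_clauses[OF assms])

text \<open>If \<open>z\<close> is the point of \<open>L\<close> nearest to \<open>y\<close>, then
  \<open>y - z\<close> is an outer normal of \<open>L\<close> at \<open>z\<close>; testing the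
  hypothesis in this single direction bounds \<open>norm (y - z)\<close>. The case
  \<open>e = 0\<close> yields inclusion, general \<open>e\<close> one half of a Hausdorff
  estimate.\<close>

lemma infdist_le_of_support_fun_le:
  assumes K: "bounded K" and L: "compact L" "convex L" "L \<noteq> {}" and e: "0 \<le> e"
    and le: "\<And>x. support_fun K x \<le> support_fun L x + e * norm x"
    and y: "y \<in> K"
  shows "infdist y L \<le> e"
proof -
  define z where "z = closest_point L y"
  have z: "z \<in> L"
    unfolding z_def using L by (intro closest_point_in_set compact_imp_closed)
  \<comment> \<open>The variational inequality of the nearest point says that \<open>z\<close>
    maximizes the inner product with \<open>y - z\<close> over \<open>L\<close>.\<close>
  have "support_fun L (y - z) \<le> (y - z) \<bullet> z"
  proof (rule support_fun_least[OF L(3)])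
    fix w assume "w \<in> L"
    then have "(y - z) \<bullet> (w - z) \<le> 0"
      unfolding z_def using L by (intro closest_point_dot compact_imp_closed)
    then show "(y - z) \<bullet> w \<le> (y - z) \<bullet> z" by (simp add: inner_diff_right)
  qed
  moreover have "(y - z) \<bullet> y \<le> support_fun K (y - z)"
    by (rule support_fun_upper[OF K y])
  ultimately have "(y - z) \<bullet> (y - z) \<le> e * norm (y - z)"
    using le[of "y - z"] by (simp add: inner_diff_right)
  then have "norm (y - z) * norm (y - z) \<le> e * norm (y - z)"
    by (simp add: dot_square_norm power2_eq_square)
  then have "norm (y - z) \<le> e"
    using e by (cases "norm (y - z) = 0") (auto simp: mult_le_cancel_right)
  then show ?thesis
    using infdist_le[OF z, of y] by (simp add: dist_norm)
qed

lemma subset_of_support_fun_le: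
  assumes K: "bounded K" and L: "compact L" "convex L" "L \<noteq> {}"
    and le: "\<And>x. support_fun K x \<le> support_fun L x"
  shows "K \<subseteq> L"
proof
  fix y assume "y \<in> K"
  then have "infdist y L \<le> 0"
    using le by (intro infdist_le_of_support_fun_le[OF K L]) auto
  then have "infdist y L = 0"
    using infdist_nonneg[of y L] by linarith
  then show "y \<in> L"
    using L by (simp add: in_closed_iff_infdist_zero compact_imp_closed)
qed

text \<open>Inclusion holds both ways. This makes the description behind \<open>orlicz_sum\<close>
  unique and reduces each identity between bodies to one between support functions.\<close>

lemma convex_body_eq_of_support_fun_eq:
  assumes "compact K" "convex K" "K \<noteq> {}" "compact L" "convex L" "L \<noteq> {}"
    and "\<And>x. support_fun K x = support_fun L x"
  shows "K = L"
  using assms by (intro equalityI subset_of_support_fun_le) (auto intro: compact_imp_bounded)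

section \<open>Hausdorff distance in terms of support functions\<close>

lemma bdd_above_infdist:
  fixes K L :: "'a::real_normed_vector set"
  assumes "bounded K"
  shows "bdd_above ((\<lambda>x. infdist x L) ` K)"
proof -
  obtain B where B: "\<And>x. x \<in> K \<Longrightarrow> norm x \<le> B"
    using assms bounded_iff by blast
  have "infdist x L \<le> infdist 0 L + B" if "x \<in> K" for x
    using infdist_triangle[of x L 0] B[OF that] by simp
  then show ?thesis by (auto intro: bdd_aboveI[of _ "infdist 0 L + B"])
qed

lemma infdist_le_hausdorff_dist:
  assumes "bounded K" "y \<in> K"
  shows "infdist y L \<le> hausdorff_dist K L"
  unfolding hausdorff_dist_def
  using cSUP_upper[OF assms(2) bdd_above_infdist[OF assms(1), of L]] by simp

lemma hausdorff_dist_commute: "hausdorff_dist K L = hausdorff_dist L K"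
  by (simp add: hausdorff_dist_def max.commute)

lemma hausdorff_dist_nonneg:
  assumes "bounded K" "K \<noteq> {}"
  shows "0 \<le> hausdorff_dist K L"
  using infdist_le_hausdorff_dist[OF assms(1)] assms(2) infdist_nonneg order.trans by blast

text \<open>Each \<open>y\<close> in \<open>K\<close> has a point \<open>z\<close> of
  \<open>L\<close> within the Hausdorff distance; by Cauchy-Schwarz, replacing \<open>y\<close> by
  \<open>z\<close> changes the inner product with \<open>x\<close> by at most that distance times
  \<open>norm x\<close>.\<close>

lemma support_fun_le_hausdorff_dist:
  assumes K: "bounded K" "K \<noteq> {}" and L: "compact L" "L \<noteq> {}"
  shows "support_fun K x \<le> support_fun L x + hausdorff_dist K L * norm x"
proof (rule support_fun_least[OF K(2)])
  fix y assume y: "y \<in> K"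
  obtain z where z: "z \<in> L" "infdist y L = dist y z"
    using infdist_attains_inf[OF compact_imp_closed[OF L(1)] L(2), of y] by blast
  have "norm (y - z) \<le> hausdorff_dist K L"
    using infdist_le_hausdorff_dist[OF K(1) y, of L] z(2) by (simp add: dist_norm)
  then have "x \<bullet> (y - z) \<le> norm x * hausdorff_dist K L"
    using norm_cauchy_schwarz[of x "y - z"] mult_left_mono[of "norm (y - z)" _ "norm x"]
    by fastforce
  then show "x \<bullet> y \<le> support_fun L x + hausdorff_dist K L * norm x"
    using support_fun_upper[OF compact_imp_bounded[OF L(1)] z(1), of x]
    by (simp add: inner_diff_right mult.commute)
qed

lemma support_fun_diff_le_hausdorff_dist:
  assumes "compact K" "K \<noteq> {}" "compact L" "L \<noteq> {}"
  shows "\<bar>support_fun K x - support_fun L x\<bar> \<le> hausdorff_dist K L * norm x"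
  using support_fun_le_hausdorff_dist[of K L x] support_fun_le_hausdorff_dist[of L K x] assms
  by (auto simp: compact_imp_bounded hausdorff_dist_commute[of L K] abs_le_iff)

text \<open>Converse of the preceding estimate. The factor \<open>norm x\<close> is the homogeneous
  form of a uniform bound on the unit sphere.\<close>

lemma hausdorff_dist_le_of_support_fun:
  assumes K: "compact K" "convex K" "K \<noteq> {}" and L: "compact L" "convex L" "L \<noteq> {}"
    and e: "0 \<le> e"
    and le: "\<And>x. \<bar>support_fun K x - support_fun L x\<bar> \<le> e * norm x"
  shows "hausdorff_dist K L \<le> e"
proof -
  have "support_fun K x \<le> support_fun L x + e * norm x"
    and "support_fun L x \<le> support_fun K x + e * norm x" for x
    using le[of x] by linarith+
  then have "\<forall>y\<in>K. infdist y L \<le> e" "\<forall>y\<in>L. infdist y K \<le> e"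
    using infdist_le_of_support_fun_le[OF _ L e, of K] infdist_le_of_support_fun_le[OF _ K e, of L]
      K(1) L(1) by (blast intro: compact_imp_bounded)+
  then show ?thesis
    unfolding hausdorff_dist_def using K(3) L(3) by (auto intro!: cSUP_least)
qed

section \<open>Sublinear functions are support functions\<close>

lemma sublinear_imp_convex_continuous:
  fixes H :: "'a::euclidean_space \<Rightarrow> real"
  assumes add: "\<And>x y. H (x + y) \<le> H x + H y"
    and scale: "\<And>t x. 0 \<le> t \<Longrightarrow> H (t *\<^sub>R x) = t * H x"
  shows "convex_on UNIV H" "continuous_on UNIV H"
proof -
  show "convex_on UNIV H"
    using add scale by (intro convex_onI) (metis less_eq_real_def diff_ge_0_iff_ge, simp)
  \<comment> \<open>A finite convex function on an open set in finite dimension is continuous; this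
    will make the epigraph closed.\<close>
  then show "continuous_on UNIV H"
    by (intro convex_on_continuous) auto
qed

text \<open>
  The epigraph of \<open>H\<close> is a closed convex cone; a hyperplane separating it from a point
  \<open>(x, s)\<close> with \<open>s < H x\<close> is the graph of a linear functional below \<open>H\<close> exceeding \<open>s\<close> at \<open>x\<close>.
\<close>

lemma sublinear_minorant:
  fixes H :: "'a::euclidean_space \<Rightarrow> real"
  assumes add: "\<And>x y. H (x + y) \<le> H x + H y"
    and scale: "\<And>t x. 0 \<le> t \<Longrightarrow> H (t *\<^sub>R x) = t * H x"
    and s: "s < H x"
  obtains y where "\<And>w. w \<bullet> y \<le> H w" "s < x \<bullet> y"
proof -
  define E where "E = epigraph UNIV H"
  have H0: "H 0 = 0" using scale[of 0 0] by simp
  have E_iff: "(w, t) \<in> E \<longleftrightarrow> H w \<le> t" for w t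
    by (simp add: E_def mem_epigraph)
  have conv: "convex E"
    unfolding E_def using sublinear_imp_convex_continuous(1)[OF add scale]
    by (simp add: convex_epigraph)
  have "E = {p. H (fst p) \<le> snd p}"
    by (auto simp: E_def epigraph_def)
  moreover have "closed {p. H (fst p) \<le> snd p}"
    by (intro closed_Collect_le continuous_on_compose2[OF sublinear_imp_convex_continuous(2)[OF add scale]]
        continuous_intros) auto
  ultimately have cl: "closed E" by simp
  have "(x, s) \<notin> E" using s by (simp add: E_iff)
  then obtain p c where p: "p \<bullet> (x, s) < c" "\<And>q. q \<in> E \<Longrightarrow> c < p \<bullet> q"
    using separating_hyperplane_closed_point[OF conv cl] by blast
  obtain a b where ab: "p = (a, b)" by (cases p)
  have sep: "a \<bullet> x + b * s < c" and above: "\<And>w t. H w \<le> t \<Longrightarrow> c < a \<bullet> w + b * t"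
    using p by (auto simp: ab E_iff)
  \<comment> \<open>The origin belongs to the epigraph.\<close>
  have c: "c < 0" using above[of 0 0] by (simp add: H0)
  \<comment> \<open>The epigraph is a cone: a point with negative value could be scaled by
    \<open>r\<close> to have value exactly \<open>c\<close>, against strict separation.\<close>
  have cone: "0 \<le> a \<bullet> w + b * t" if "H w \<le> t" for w t
  proof (rule ccontr)
    assume neg: "\<not> 0 \<le> a \<bullet> w + b * t"
    define r where "r = c / (a \<bullet> w + b * t)"
    have r: "0 \<le> r" using neg c by (simp add: r_def divide_nonpos_neg)
    have "c < a \<bullet> (r *\<^sub>R w) + b * (r * t)"
      using that r by (intro above) (simp add: scale mult_left_mono)
    also have "\<dots> = r * (a \<bullet> w + b * t)" by (simp add: algebra_simps)
    also have "\<dots> = c" using neg by (simp add: r_def)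
    finally show False by simp
  qed
  \<comment> \<open>The hyperplane is not vertical: for \<open>b = 0\<close>, testing
    \<open>cone\<close> at \<open>- a\<close> forces \<open>a = 0\<close>, and then
    \<open>sep\<close> gives \<open>0 < c\<close>.\<close>
  have "b \<noteq> 0"
  proof
    assume b: "b = 0"
    then have "a \<bullet> a \<le> 0" using cone[of "- a" "H (- a)"] by simp
    then have "a = 0" by (simp add: inner_gt_zero_iff flip: not_less)
    then show False using sep b c by simp
  qed
  then have b: "b > 0" using cone[of 0 1] by (simp add: H0)
  \<comment> \<open>Slope obtained by solving \<open>a \<bullet> w + b * t = 0\<close> for
    \<open>t\<close>.\<close>
  define y where "y = - (inverse b *\<^sub>R a)"
  have "w \<bullet> y \<le> H w" for w
  proof -
    have "0 \<le> inverse b * (a \<bullet> w + b * H w)" using cone[of w "H w"] b by simp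
    also have "\<dots> = H w - w \<bullet> y"
      using b by (simp add: y_def inner_commute distrib_left)
    finally show ?thesis by simp
  qed
  moreover have "s < x \<bullet> y"
  proof -
    have "inverse b * (a \<bullet> x + b * s) < 0"
      using sep c b by (intro mult_pos_neg) auto
    moreover have "inverse b * (a \<bullet> x + b * s) = s - x \<bullet> y"
      using b by (simp add: y_def inner_commute distrib_left)
    ultimately show ?thesis by simp
  qed
  ultimately show thesis by (rule that)
qed

text \<open>The linear functionals dominated by \<open>H\<close> (its subdifferential at the origin)
  form an intersection of closed half-spaces, bounded by testing on plus and minus the basis
  vectors. By \<open>sublinear_minorant\<close>, their supremum reaches \<open>H\<close> at every
  point.\<close>

lemma sublinear_is_support_fun:
  fixes H :: "real ^ 'n \<Rightarrow> real"
  assumes add: "\<And>x y. H (x + y) \<le> H x + H y"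
    and scale: "\<And>t x. 0 \<le> t \<Longrightarrow> H (t *\<^sub>R x) = t * H x"
  obtains L where "L \<noteq> {}" "compact L" "convex L" "\<And>x. support_fun L x = H x"
proof -
  define L where "L = {y. \<forall>x. x \<bullet> y \<le> H x}"
  have L_eq: "L = (\<Inter>x. {y. x \<bullet> y \<le> H x})" by (auto simp: L_def)
  have conv: "convex L" unfolding L_eq by (intro convex_INT convex_halfspace_le)
  have "closed L" unfolding L_eq by (intro closed_INT ballI closed_halfspace_le)
  moreover have "bounded L"
  proof (rule bounded_subset[OF bounded_cbox])
    show "L \<subseteq> cbox (\<Sum>i\<in>Basis. - H (- i) *\<^sub>R i) (\<Sum>i\<in>Basis. H i *\<^sub>R i)"
    proof
      fix y assume "y \<in> L"
      then have "i \<bullet> y \<le> H i" "- i \<bullet> y \<le> H (- i)" for i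
        unfolding L_def by blast+
      then show "y \<in> cbox (\<Sum>i\<in>Basis. - H (- i) *\<^sub>R i) (\<Sum>i\<in>Basis. H i *\<^sub>R i)"
        by (auto simp: mem_box inner_commute[of y] minus_le_iff simp del: scaleR_minus_left)
    qed
  qed
  ultimately have comp: "compact L" by (simp add: compact_eq_bounded_closed)
  have attain: "\<exists>y\<in>L. s < x \<bullet> y" if "s < H x" for s x
    using sublinear_minorant[OF add scale that] unfolding L_def by blast
  have ne: "L \<noteq> {}" using attain[of "H 0 - 1" 0] by auto
  have "support_fun L x = H x" for x
  proof (rule antisym)
    show "support_fun L x \<le> H x"
      by (intro support_fun_least[OF ne]) (simp add: L_def)
    show "H x \<le> support_fun L x"
    proof (rule ccontr)
      assume "\<not> H x \<le> support_fun L x"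
      then obtain y where "y \<in> L" "support_fun L x < x \<bullet> y"
        using attain[of "support_fun L x" x] by auto
      then show False
        using support_fun_upper[OF \<open>bounded L\<close>, of y x] by linarith
    qed
  qed
  then show thesis using that ne comp conv by blast
qed

section \<open>The gauge of an Orlicz function\<close>

text \<open>Separates the role of \<open>\<phi>\<close> from that of the bodies: all estimates on
  \<open>\<phi>\<close> take place on vectors of the orthant.\<close>

definition orlicz_gauge :: "(real ^ 'm \<Rightarrow> real) \<Rightarrow> real ^ 'm \<Rightarrow> real" where
  "orlicz_gauge \<phi> h = Inf {l. 0 < l \<and> \<phi> (h /\<^sub>R l) \<le> 1}"

lemma orlicz_support_eq_gauge:
  "orlicz_support \<phi> K x = orlicz_gauge \<phi> (\<chi> j. support_fun (K j) x)"
proof -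
  have "(\<chi> j. support_fun (K j) x / l) = (\<chi> j. support_fun (K j) x) /\<^sub>R l" for l
    by (simp add: vec_eq_iff divide_inverse_commute)
  then show ?thesis by (simp add: orlicz_support_def orlicz_gauge_def)
qed

lemma orthant_nth: "h \<in> orthant \<Longrightarrow> 0 \<le> h $ j"
  by (simp add: orthant_def)

lemma orthant_add: "h \<in> orthant \<Longrightarrow> k \<in> orthant \<Longrightarrow> h + k \<in> orthant"
  by (simp add: orthant_def)

lemma orthant_scaleR: "h \<in> orthant \<Longrightarrow> 0 \<le> t \<Longrightarrow> t *\<^sub>R h \<in> orthant"
  by (simp add: orthant_def)

text \<open>Monotonicity in one variable compares only points differing in one coordinate, so
  \<open>h\<close> is changed into \<open>k\<close> one coordinate at a time; \<open>A\<close>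
  collects the coordinates already changed.\<close>

lemma Orlicz_Phi_mono:
  fixes \<phi> :: "real ^ 'm \<Rightarrow> real"
  assumes phi: "\<phi> \<in> Orlicz_Phi" and h: "h \<in> orthant" and le: "\<And>j. h $ j \<le> k $ j"
  shows "\<phi> h \<le> \<phi> k"
proof -
  have k: "k \<in> orthant"
    using h le order.trans unfolding orthant_def by blast
  have "\<phi> h \<le> \<phi> (\<chi> i. if i \<in> A then k $ i else h $ i)" if "finite A" for A
    using that
  proof (induction A)
    case empty
    then show ?case by simp
  next
    case (insert a A)
    have "\<phi> (\<chi> i. if i \<in> A then k $ i else h $ i) \<le> \<phi> (\<chi> i. if i \<in> insert a A then k $ i else h $ i)"
      using phi insert.hyps(2) h k le unfolding Orlicz_Phi_def mem_Collect_eq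
      by (elim conjE allE[of _ a]) (simp add: orthant_def)
    then show ?case using insert.IH by linarith
  qed
  from this[of UNIV] show ?thesis by simp
qed

lemma convex_Orlicz_Phi_sublevel:
  fixes \<phi> :: "real ^ 'm \<Rightarrow> real"
  assumes "\<phi> \<in> Orlicz_Phi"
  shows "convex {h \<in> orthant. \<phi> h \<le> 1}"
proof (rule convexI)
  fix h k :: "real ^ 'm" and u v :: real
  assume hk: "h \<in> {h \<in> orthant. \<phi> h \<le> 1}" "k \<in> {h \<in> orthant. \<phi> h \<le> 1}"
    and uv: "0 \<le> u" "0 \<le> v" "u + v = 1"
  have "convex_on orthant \<phi>" using assms by (simp add: Orlicz_Phi_def)
  then have "\<phi> (u *\<^sub>R h + v *\<^sub>R k) \<le> u * \<phi> h + v * \<phi> k"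
    using hk uv by (auto simp: convex_on_def)
  also have "\<dots> \<le> 1"
    using hk uv by (intro convex_bound_le) auto
  finally show "u *\<^sub>R h + v *\<^sub>R k \<in> {h \<in> orthant. \<phi> h \<le> 1}"
    using hk uv by (simp add: orthant_add orthant_scaleR)
qed

lemma orlicz_gauge_le:
  assumes "0 < l" "\<phi> (h /\<^sub>R l) \<le> 1"
  shows "orlicz_gauge \<phi> h \<le> l"
  unfolding orlicz_gauge_def using assms
  by (intro cInf_lower) (auto intro: bdd_belowI[of _ 0])

text \<open>Divided by its coordinate sum, a nonzero \<open>h\<close> is a convex combination of the
  basis vectors, all of which lie in the convex set \<open>{\<phi> \<le> 1}\<close>; a larger
  divisor only decreases \<open>\<phi>\<close>. Hence the gauge is finite and at most the coordinate
  sum.\<close>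

lemma Orlicz_Phi_scaled_le_one:
  fixes \<phi> :: "real ^ 'm \<Rightarrow> real"
  assumes phi: "\<phi> \<in> Orlicz_Phi" and h: "h \<in> orthant"
    and l: "0 < l" "(\<Sum>j\<in>UNIV. h $ j) \<le> l"
  shows "\<phi> (h /\<^sub>R l) \<le> 1"
proof -
  define s where "s = (\<Sum>j\<in>UNIV. h $ j)"
  have s: "0 \<le> s" unfolding s_def using h by (intro sum_nonneg) (simp add: orthant_nth)
  show ?thesis
  proof (cases "s = 0")
    case True
    then have "h = 0"
      unfolding s_def using h by (simp add: sum_nonneg_eq_0_iff orthant_nth vec_eq_iff)
    then show ?thesis using phi by (simp add: Orlicz_Phi_def)
  next
    case False
    then have pos: "0 < s" using s by simp
    have "(\<Sum>j\<in>UNIV. (h $ j / s) *\<^sub>R axis j 1) \<in> {h \<in> orthant. \<phi> h \<le> 1}"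
    proof (intro convex_sum convex_Orlicz_Phi_sublevel phi)
      show "(\<Sum>j\<in>UNIV. h $ j / s) = 1"
        using pos by (simp add: s_def flip: sum_divide_distrib)
      show "axis j 1 \<in> {h \<in> orthant. \<phi> h \<le> 1}" for j
        using phi by (auto simp: Orlicz_Phi_def orthant_def axis_def)
    qed (use h pos in \<open>auto simp: orthant_nth\<close>)
    moreover have "(\<Sum>j\<in>UNIV. (h $ j / s) *\<^sub>R axis j 1) = h /\<^sub>R s"
      by (simp add: vec_eq_iff axis_def if_distrib[of "\<lambda>t. _ * t"] divide_inverse_commute cong: if_cong)
    ultimately have "\<phi> (h /\<^sub>R s) \<le> 1" by simp
    moreover have "\<phi> (h /\<^sub>R l) \<le> \<phi> (h /\<^sub>R s)"
      using h l pos by (intro Orlicz_Phi_mono[OF phi] orthant_scaleR)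
        (auto simp: s_def orthant_nth intro!: mult_right_mono le_imp_inverse_le)
    ultimately show ?thesis by simp
  qed
qed

lemma orlicz_gauge_set_nonempty:
  fixes \<phi> :: "real ^ 'm \<Rightarrow> real"
  assumes "\<phi> \<in> Orlicz_Phi" "h \<in> orthant"
  shows "{l. 0 < l \<and> \<phi> (h /\<^sub>R l) \<le> 1} \<noteq> {}"
proof -
  have "0 \<le> (\<Sum>j\<in>UNIV. h $ j)" using assms(2) by (intro sum_nonneg) (simp add: orthant_nth)
  \<comment> \<open>Adding 1 keeps the divisor positive even for \<open>h = 0\<close>.\<close>
  then have "\<phi> (h /\<^sub>R ((\<Sum>j\<in>UNIV. h $ j) + 1)) \<le> 1"
    by (intro Orlicz_Phi_scaled_le_one[OF assms]) auto
  then show ?thesis using \<open>0 \<le> _\<close> by (auto intro!: exI[of _ "(\<Sum>j\<in>UNIV. h $ j) + 1"])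
qed

lemma orlicz_gauge_greatest:
  assumes "\<phi> \<in> Orlicz_Phi" "h \<in> orthant"
    and "\<And>l. 0 < l \<Longrightarrow> \<phi> (h /\<^sub>R l) \<le> 1 \<Longrightarrow> b \<le> l"
  shows "b \<le> orlicz_gauge \<phi> h"
  unfolding orlicz_gauge_def
  using assms(3) by (intro cInf_greatest[OF orlicz_gauge_set_nonempty[OF assms(1,2)]]) auto

lemma orlicz_gauge_le_sum:
  assumes "\<phi> \<in> Orlicz_Phi" "h \<in> orthant"
  shows "orlicz_gauge \<phi> h \<le> (\<Sum>j\<in>UNIV. h $ j)"
\<comment> \<open>Approaching the sum from above keeps \<open>l\<close> positive when the sum
  vanishes.\<close>
proof (rule dense_ge)
  fix l assume l: "(\<Sum>j\<in>UNIV. h $ j) < l"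
  have "0 \<le> (\<Sum>j\<in>UNIV. h $ j)" using assms(2) by (intro sum_nonneg) (simp add: orthant_nth)
  then show "orlicz_gauge \<phi> h \<le> l"
    using l by (intro orlicz_gauge_le Orlicz_Phi_scaled_le_one[OF assms]) auto
qed

lemma orlicz_gauge_nonneg:
  assumes "\<phi> \<in> Orlicz_Phi" "h \<in> orthant"
  shows "0 \<le> orlicz_gauge \<phi> h"
  by (rule orlicz_gauge_greatest[OF assms]) simp

lemma orlicz_gauge_mono:
  assumes "\<phi> \<in> Orlicz_Phi" "h \<in> orthant" "\<And>j. h $ j \<le> k $ j"
  shows "orlicz_gauge \<phi> h \<le> orlicz_gauge \<phi> k"
proof (rule orlicz_gauge_greatest[OF assms(1)])
  show "k \<in> orthant"
    using assms(2,3) order.trans unfolding orthant_def by blast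
  fix l :: real assume l: "0 < l" "\<phi> (k /\<^sub>R l) \<le> 1"
  have "\<phi> (h /\<^sub>R l) \<le> \<phi> (k /\<^sub>R l)"
  proof (rule Orlicz_Phi_mono[OF assms(1)])
    show "h /\<^sub>R l \<in> orthant" using assms(2) l(1) by (simp add: orthant_scaleR)
    show "(h /\<^sub>R l) $ j \<le> (k /\<^sub>R l) $ j" for j
      using mult_left_mono[OF assms(3)[of j], of "inverse l"] l(1) by simp
  qed
  then show "orlicz_gauge \<phi> h \<le> l"
    using l by (intro orlicz_gauge_le) auto
qed

text \<open>For admissible \<open>l\<close> and \<open>r\<close>,
  \<open>(h + k) /\<^sub>R (l + r)\<close> is the convex combination of \<open>h /\<^sub>R l\<close>
  and \<open>k /\<^sub>R r\<close> with weights \<open>l / (l + r)\<close> and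
  \<open>r / (l + r)\<close>, so \<open>l + r\<close> is admissible for
  \<open>h + k\<close>.\<close>

lemma orlicz_gauge_add:
  assumes phi: "\<phi> \<in> Orlicz_Phi" and h: "h \<in> orthant" and k: "k \<in> orthant"
  shows "orlicz_gauge \<phi> (h + k) \<le> orlicz_gauge \<phi> h + orlicz_gauge \<phi> k"
proof -
  have "orlicz_gauge \<phi> (h + k) \<le> l + r"
    if l: "0 < l" "\<phi> (h /\<^sub>R l) \<le> 1" and r: "0 < r" "\<phi> (k /\<^sub>R r) \<le> 1" for l r
  proof (rule orlicz_gauge_le)
    have "(l / (l + r)) *\<^sub>R (h /\<^sub>R l) + (r / (l + r)) *\<^sub>R (k /\<^sub>R r) \<in> {h \<in> orthant. \<phi> h \<le> 1}"
      using l r h k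
      by (intro convexD[OF convex_Orlicz_Phi_sublevel[OF phi]])
        (auto intro: orthant_scaleR simp flip: add_divide_distrib)
    moreover have "(l / (l + r)) *\<^sub>R (h /\<^sub>R l) + (r / (l + r)) *\<^sub>R (k /\<^sub>R r) = (h + k) /\<^sub>R (l + r)"
    proof -
      have "l / (l + r) * inverse l = inverse (l + r)" "r / (l + r) * inverse r = inverse (l + r)"
        using l(1) r(1) by (simp_all add: field_simps)
      then show ?thesis by (simp only: scaleR_scaleR scaleR_add_right)
    qed
    ultimately show "\<phi> ((h + k) /\<^sub>R (l + r)) \<le> 1" by simp
  qed (use l r in simp)
  \<comment> \<open>The infimum is taken over \<open>l\<close> first, with \<open>r\<close> fixed,
    and then over \<open>r\<close>.\<close>
  then have "orlicz_gauge \<phi> (h + k) - r \<le> orlicz_gauge \<phi> h" if "0 < r" "\<phi> (k /\<^sub>R r) \<le> 1" for r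
    using that by (intro orlicz_gauge_greatest[OF phi h]) (simp add: diff_le_eq)
  then have "orlicz_gauge \<phi> (h + k) - orlicz_gauge \<phi> h \<le> orlicz_gauge \<phi> k"
    by (intro orlicz_gauge_greatest[OF phi k]) (simp add: diff_le_eq add.commute)
  then show ?thesis by simp
qed

lemma orlicz_gauge_zero:
  assumes "\<phi> \<in> Orlicz_Phi"
  shows "orlicz_gauge \<phi> 0 = 0"
  using orlicz_gauge_nonneg[OF assms, of 0] orlicz_gauge_le_sum[OF assms, of 0]
  by (simp add: orthant_def)

lemma orlicz_gauge_scaleR:
  assumes phi: "\<phi> \<in> Orlicz_Phi" and h: "h \<in> orthant" and t: "0 \<le> t"
  shows "orlicz_gauge \<phi> (t *\<^sub>R h) = t * orlicz_gauge \<phi> h"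
proof (cases "t = 0")
  case True
  then show ?thesis by (simp add: orlicz_gauge_zero[OF phi])
next
  case False
  then have pos: "t > 0" using t by simp
  \<comment> \<open>If \<open>l\<close> is admissible for \<open>k\<close>, then
    \<open>s * l\<close> is for \<open>s *\<^sub>R k\<close>; the reverse inequality again comes
    from the factor \<open>inverse t\<close>.\<close>
  have le: "orlicz_gauge \<phi> (s *\<^sub>R k) \<le> s * orlicz_gauge \<phi> k" if s: "s > 0" and k: "k \<in> orthant" for s k
  proof -
    have "orlicz_gauge \<phi> (s *\<^sub>R k) / s \<le> orlicz_gauge \<phi> k"
    proof (rule orlicz_gauge_greatest[OF phi k])
      fix l :: real assume l: "0 < l" "\<phi> (k /\<^sub>R l) \<le> 1"
      have eq: "(s *\<^sub>R k) /\<^sub>R (s * l) = k /\<^sub>R l"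
        using s by (simp add: mult.assoc mult.left_commute)
      have "orlicz_gauge \<phi> (s *\<^sub>R k) \<le> s * l"
        by (rule orlicz_gauge_le) (use s l in \<open>simp_all only: eq zero_less_mult_iff simp_thms\<close>)
      then show "orlicz_gauge \<phi> (s *\<^sub>R k) / s \<le> l"
        using s by (simp add: divide_le_eq mult.commute)
    qed
    then show ?thesis using s by (simp add: divide_le_eq mult.commute)
  qed
  have "orlicz_gauge \<phi> h \<le> inverse t * orlicz_gauge \<phi> (t *\<^sub>R h)"
    using le[of "inverse t" "t *\<^sub>R h"] pos h by (simp add: orthant_scaleR)
  then show ?thesis
    using le[OF pos h] pos by (simp add: field_simps)
qed

text \<open>Here the normalization of \<open>\<phi>\<close> enters: its value 1 at a basis vector
  makes \<open>l = 1\<close> admissible, while convexity and \<open>\<phi> 0 = 0\<close> exclude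
  \<open>l < 1\<close>. Homogeneity does the rest. This is the source of the identity
  property.\<close>

lemma orlicz_gauge_axis:
  assumes phi: "\<phi> \<in> Orlicz_Phi" and t: "0 \<le> t"
  shows "orlicz_gauge \<phi> (axis j t) = t"
proof -
  have e: "axis j 1 \<in> orthant" by (simp add: orthant_def axis_def)
  have "1 \<le> l" if l: "0 < l" "\<phi> (axis j 1 /\<^sub>R l) \<le> 1" for l
  proof (rule ccontr)
    assume "\<not> 1 \<le> l"
    then have l1: "l < 1" by simp
    have cvx: "convex_on orthant \<phi>" and zero: "\<phi> 0 = 0" and one: "\<phi> (axis j 1) = 1"
      using phi by (auto simp: Orlicz_Phi_def)
    \<comment> \<open>The basis vector lies on the segment from the origin to
      \<open>axis j 1 /\<^sub>R l\<close>.\<close>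
    have "\<phi> ((1 - l) *\<^sub>R 0 + l *\<^sub>R (axis j 1 /\<^sub>R l)) \<le> (1 - l) * \<phi> 0 + l * \<phi> (axis j 1 /\<^sub>R l)"
      using l l1 e by (intro convex_onD[OF cvx] orthant_scaleR) (auto simp: orthant_def)
    then have "1 \<le> l * \<phi> (axis j 1 /\<^sub>R l)"
      using l(1) by (simp add: zero one)
    also have "\<dots> \<le> l" using l by (simp add: mult_left_le)
    finally show False using l1 by simp
  qed
  then have "1 \<le> orlicz_gauge \<phi> (axis j 1)"
    by (intro orlicz_gauge_greatest[OF phi e])
  moreover have "orlicz_gauge \<phi> (axis j 1) \<le> 1"
    using phi by (intro orlicz_gauge_le) (auto simp: Orlicz_Phi_def)
  ultimately have one: "orlicz_gauge \<phi> (axis j 1) = 1" by simp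
  have "axis j t = t *\<^sub>R axis j 1"
    by (simp add: vec_eq_iff axis_def)
  then show ?thesis
    using orlicz_gauge_scaleR[OF phi e t] one by simp
qed

lemma orlicz_gauge_diff_le:
  assumes phi: "\<phi> \<in> Orlicz_Phi" and h: "h \<in> orthant" and k: "k \<in> orthant"
  shows "\<bar>orlicz_gauge \<phi> h - orlicz_gauge \<phi> k\<bar> \<le> (\<Sum>j\<in>UNIV. \<bar>h $ j - k $ j\<bar>)"
proof -
  \<comment> \<open>Adding \<open>d\<close> to either vector makes it dominate the other.\<close>
  define d where "d = (\<chi> j. \<bar>h $ j - k $ j\<bar>)"
  have d: "d \<in> orthant" by (simp add: d_def orthant_def)
  have "orlicz_gauge \<phi> h \<le> orlicz_gauge \<phi> (k + d)"
    using h by (intro orlicz_gauge_mono[OF phi]) (auto simp: d_def)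
  moreover have "orlicz_gauge \<phi> k \<le> orlicz_gauge \<phi> (h + d)"
    using k by (intro orlicz_gauge_mono[OF phi]) (auto simp: d_def)
  moreover have "orlicz_gauge \<phi> d \<le> (\<Sum>j\<in>UNIV. \<bar>h $ j - k $ j\<bar>)"
    using orlicz_gauge_le_sum[OF phi d] by (simp add: d_def)
  ultimately show ?thesis
    using orlicz_gauge_add[OF phi h d] orlicz_gauge_add[OF phi k d] by linarith
qed

section \<open>Orlicz sums\<close>

lemma convex_bodies_oD:
  assumes "K \<in> convex_bodies_o"
  shows "compact K" "bounded K" "convex K" "0 \<in> K" "K \<noteq> {}"
  using assms by (auto simp: convex_bodies_o_def compact_imp_bounded)

lemma support_vector_in_orthant:
  assumes "\<And>j. K j \<in> convex_bodies_o"
  shows "(\<chi> j. support_fun (K j) x) \<in> orthant"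
  using assms by (simp add: orthant_def support_fun_nonneg convex_bodies_oD)

text \<open>Support functions are only subadditive, so monotonicity of the gauge is needed, besides
  its sublinearity, to make the composition sublinear.\<close>

lemma orlicz_sum_exists_unique:
  assumes phi: "\<phi> \<in> Orlicz_Phi" and K: "\<And>j. K j \<in> convex_bodies_o"
  shows "\<exists>!L. is_orlicz_sum \<phi> K L"
proof -
  note orth = support_vector_in_orthant[of K, OF K]
  have "orlicz_support \<phi> K (x + y) \<le> orlicz_support \<phi> K x + orlicz_support \<phi> K y" for x y
  proof -
    have "orlicz_support \<phi> K (x + y)
        \<le> orlicz_gauge \<phi> ((\<chi> j. support_fun (K j) x) + (\<chi> j. support_fun (K j) y))"
      unfolding orlicz_support_eq_gauge using K
      by (intro orlicz_gauge_mono phi orth) (simp add: support_fun_add convex_bodies_oD)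
    also have "\<dots> \<le> orlicz_support \<phi> K x + orlicz_support \<phi> K y"
      unfolding orlicz_support_eq_gauge by (intro orlicz_gauge_add phi orth)
    finally show ?thesis .
  qed
  moreover have "orlicz_support \<phi> K (t *\<^sub>R x) = t * orlicz_support \<phi> K x" if "0 \<le> t" for t x
  proof -
    have "(\<chi> j. support_fun (K j) (t *\<^sub>R x)) = t *\<^sub>R (\<chi> j. support_fun (K j) x)"
      using that K by (simp add: vec_eq_iff support_fun_scaleR convex_bodies_oD)
    then show ?thesis
      unfolding orlicz_support_eq_gauge using orlicz_gauge_scaleR[OF phi orth that] by simp
  qed
  ultimately obtain L where "is_orlicz_sum \<phi> K L"
    unfolding is_orlicz_sum_def by (metis sublinear_is_support_fun)
  then show ?thesis
  proof (rule ex1I)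
    fix M assume "is_orlicz_sum \<phi> K M"
    with \<open>is_orlicz_sum \<phi> K L\<close> show "M = L"
      unfolding is_orlicz_sum_def by (intro convex_body_eq_of_support_fun_eq) auto
  qed
qed

lemma orlicz_sum_props:
  assumes "\<phi> \<in> Orlicz_Phi" "\<And>j. K j \<in> convex_bodies_o"
  shows "orlicz_sum \<phi> K \<noteq> {}" "compact (orlicz_sum \<phi> K)" "convex (orlicz_sum \<phi> K)"
    and "support_fun (orlicz_sum \<phi> K) x = orlicz_support \<phi> K x"
proof -
  have "is_orlicz_sum \<phi> K (orlicz_sum \<phi> K)"
    unfolding orlicz_sum_def by (rule theI'[OF orlicz_sum_exists_unique]) (use assms in auto)
  then show "orlicz_sum \<phi> K \<noteq> {}" "compact (orlicz_sum \<phi> K)" "convex (orlicz_sum \<phi> K)"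
    "support_fun (orlicz_sum \<phi> K) x = orlicz_support \<phi> K x"
    by (auto simp: is_orlicz_sum_def)
qed

lemma orlicz_sum_eqI:
  assumes "\<phi> \<in> Orlicz_Phi" "\<And>j. K j \<in> convex_bodies_o"
    and "L \<noteq> {}" "compact L" "convex L" "\<And>x. support_fun L x = orlicz_support \<phi> K x"
  shows "orlicz_sum \<phi> K = L"
  using assms(3-) orlicz_sum_props[of \<phi> K, OF assms(1,2)]
  by (intro convex_body_eq_of_support_fun_eq) auto

lemma orlicz_sum_in_convex_bodies_o:
  assumes phi: "\<phi> \<in> Orlicz_Phi" and K: "\<And>j. K j \<in> convex_bodies_o"
  shows "orlicz_sum \<phi> K \<in> convex_bodies_o"
proof -
  note props = orlicz_sum_props[of \<phi> K, OF phi K]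
  \<comment> \<open>The gauge is nonnegative, so the support function of the sum dominates that of
    the origin.\<close>
  have "{0} \<subseteq> orlicz_sum \<phi> K"
    using props orlicz_gauge_nonneg[OF phi support_vector_in_orthant[of K, OF K]]
    by (intro subset_of_support_fun_le)
      (auto simp: support_fun_singleton_zero orlicz_support_eq_gauge)
  then show ?thesis using props by (simp add: convex_bodies_o_def)
qed

lemma orlicz_sum_mono:
  assumes phi: "\<phi> \<in> Orlicz_Phi" and K: "\<And>j. K j \<in> convex_bodies_o"
    and L: "\<And>j. L j \<in> convex_bodies_o" and sub: "\<And>j. K j \<subseteq> L j"
  shows "orlicz_sum \<phi> K \<subseteq> orlicz_sum \<phi> L"
proof (rule subset_of_support_fun_le)
  show "support_fun (orlicz_sum \<phi> K) x \<le> support_fun (orlicz_sum \<phi> L) x" for x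
    unfolding orlicz_sum_props(4)[of \<phi> K, OF phi K] orlicz_sum_props(4)[of \<phi> L, OF phi L]
      orlicz_support_eq_gauge
    using K L sub
    by (intro orlicz_gauge_mono phi support_vector_in_orthant)
      (auto intro!: support_fun_mono dest: convex_bodies_oD)
qed (use orlicz_sum_props[of \<phi> K, OF phi K] orlicz_sum_props[of \<phi> L, OF phi L]
    in \<open>auto intro: compact_imp_bounded\<close>)

text \<open>The Lipschitz bound for the gauge, applied at each \<open>x\<close> and combined with
  both Hausdorff estimates; continuity follows by squeezing.\<close>

lemma hausdorff_dist_orlicz_sum_le:
  fixes K L :: "'m::finite \<Rightarrow> (real ^ 'n) set"
  assumes phi: "\<phi> \<in> Orlicz_Phi" and K: "\<And>j. K j \<in> convex_bodies_o"
    and L: "\<And>j. L j \<in> convex_bodies_o"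
  shows "hausdorff_dist (orlicz_sum \<phi> K) (orlicz_sum \<phi> L)
    \<le> (\<Sum>j\<in>UNIV. hausdorff_dist (K j) (L j))"
proof (rule hausdorff_dist_le_of_support_fun)
  show "0 \<le> (\<Sum>j\<in>UNIV. hausdorff_dist (K j) (L j))"
    using K by (intro sum_nonneg hausdorff_dist_nonneg) (auto dest: convex_bodies_oD)
  fix x
  have "\<bar>support_fun (orlicz_sum \<phi> K) x - support_fun (orlicz_sum \<phi> L) x\<bar>
      \<le> (\<Sum>j\<in>UNIV. \<bar>support_fun (K j) x - support_fun (L j) x\<bar>)"
    using orlicz_gauge_diff_le[OF phi support_vector_in_orthant[of K, OF K]
        support_vector_in_orthant[of L, OF L], of x x]
    by (simp add: orlicz_sum_props(4) phi K L orlicz_support_eq_gauge)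
  also have "\<dots> \<le> (\<Sum>j\<in>UNIV. hausdorff_dist (K j) (L j) * norm x)"
    using K L by (intro sum_mono support_fun_diff_le_hausdorff_dist) (auto dest: convex_bodies_oD)
  also have "\<dots> = (\<Sum>j\<in>UNIV. hausdorff_dist (K j) (L j)) * norm x"
    by (simp add: sum_distrib_right)
  finally show "\<bar>support_fun (orlicz_sum \<phi> K) x - support_fun (orlicz_sum \<phi> L) x\<bar>
      \<le> (\<Sum>j\<in>UNIV. hausdorff_dist (K j) (L j)) * norm x" .
qed (use orlicz_sum_props[of \<phi> K, OF phi K] orlicz_sum_props[of \<phi> L, OF phi L] in auto)

lemma orlicz_sum_tendsto:
  fixes K :: "nat \<Rightarrow> 'm::finite \<Rightarrow> (real ^ 'n) set"
  assumes phi: "\<phi> \<in> Orlicz_Phi" and K: "\<And>i j. K i j \<in> convex_bodies_o"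
    and L: "\<And>j. L j \<in> convex_bodies_o"
    and lim: "\<And>j. (\<lambda>i. hausdorff_dist (K i j) (L j)) \<longlonglongrightarrow> 0"
  shows "(\<lambda>i. hausdorff_dist (orlicz_sum \<phi> (K i)) (orlicz_sum \<phi> L)) \<longlonglongrightarrow> 0"
proof (rule tendsto_sandwich[where f = "\<lambda>_. 0"])
  show "(\<lambda>i. \<Sum>j\<in>UNIV. hausdorff_dist (K i j) (L j)) \<longlonglongrightarrow> 0"
    using lim by (intro tendsto_null_sum)
  show "\<forall>\<^sub>F i in sequentially. 0 \<le> hausdorff_dist (orlicz_sum \<phi> (K i)) (orlicz_sum \<phi> L)"
    using orlicz_sum_props[OF phi K]
    by (intro always_eventually allI hausdorff_dist_nonneg compact_imp_bounded) auto
  show "\<forall>\<^sub>F i in sequentially. hausdorff_dist (orlicz_sum \<phi> (K i)) (orlicz_sum \<phi> L)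
      \<le> (\<Sum>j\<in>UNIV. hausdorff_dist (K i j) (L j))"
    using phi K L by (intro always_eventually allI hausdorff_dist_orlicz_sum_le)
qed (rule tendsto_const)

section \<open>Linear images, the identity property and orthogonal projections\<close>

lemma compact_linear_image:
  fixes f :: "'a::euclidean_space \<Rightarrow> 'b::real_normed_vector"
  assumes "linear f" "compact K"
  shows "compact (f ` K)"
  using assms by (intro compact_continuous_image linear_continuous_on) (auto simp: linear_conv_bounded_linear)

lemma linear_image_in_convex_bodies_o:
  fixes f :: "real ^ 'n \<Rightarrow> real ^ 'k"
  assumes "linear f" "K \<in> convex_bodies_o"
  shows "f ` K \<in> convex_bodies_o"
proof -
  have "f 0 \<in> f ` K" using assms(2) by (intro imageI) (simp add: convex_bodies_o_def)
  then show ?thesis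
    using assms linear_0[OF assms(1)]
    by (simp add: convex_bodies_o_def compact_linear_image convex_linear_image)
qed

text \<open>The adjoint moves to the argument \<open>x\<close>, which all support functions share,
  so it passes through the gauge. Covariance under \<open>GL(n)\<close>, covariance under
  projections and preservation of symmetry are all instances.\<close>

lemma orlicz_sum_linear_image:
  fixes f :: "real ^ 'n \<Rightarrow> real ^ 'k"
  assumes f: "linear f" and phi: "\<phi> \<in> Orlicz_Phi" and K: "\<And>j. K j \<in> convex_bodies_o"
  shows "f ` orlicz_sum \<phi> K = orlicz_sum \<phi> (\<lambda>j. f ` K j)"
proof (rule orlicz_sum_eqI[symmetric])
  show "support_fun (f ` orlicz_sum \<phi> K) x = orlicz_support \<phi> (\<lambda>j. f ` K j) x" for x
    by (simp add: support_fun_linear_image[OF f] orlicz_sum_props(4) phi K orlicz_support_eq_gauge)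
qed (use f phi K orlicz_sum_props[of \<phi> K, OF phi K] in
    \<open>auto intro: linear_image_in_convex_bodies_o compact_linear_image convex_linear_image\<close>)

lemma orlicz_sum_single:
  assumes phi: "\<phi> \<in> Orlicz_Phi" and M: "M \<in> convex_bodies_o"
  shows "orlicz_sum \<phi> (\<lambda>i. if i = j then M else {0}) = M"
proof (rule orlicz_sum_eqI[OF phi])
  show "(if i = j then M else {0}) \<in> convex_bodies_o" for i
    using M by (simp add: convex_bodies_o_def)
  show "support_fun M x = orlicz_support \<phi> (\<lambda>i. if i = j then M else {0}) x" for x
  proof -
    \<comment> \<open>All other bodies have support function zero, so only the gauge on the
      \<open>j\<close>th axis matters.\<close>
    have "(\<chi> i. support_fun (if i = j then M else {0}) x) = axis j (support_fun M x)"
      by (simp add: vec_eq_iff axis_def support_fun_singleton_zero)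
    then show ?thesis
      using M by (simp add: orlicz_support_eq_gauge orlicz_gauge_axis[OF phi]
          support_fun_nonneg convex_bodies_oD)
  qed
qed (use M in \<open>auto dest: convex_bodies_oD\<close>)

lemma orth_proj_eqI:
  assumes S: "subspace S" and y: "y \<in> S" "x - y \<in> S\<^sup>\<bottom>"
  shows "orth_proj S x = y"
  unfolding orth_proj_def
proof (rule the_equality)
  fix z assume z: "z \<in> S \<and> x - z \<in> S\<^sup>\<bottom>"
  have "z - y \<in> S" using S y z by (simp add: subspace_diff)
  moreover have "(x - y) - (x - z) \<in> S\<^sup>\<bottom>"
    using y(2) z by (blast intro: subspace_diff[OF subspace_orthogonal_comp])
  \<comment> \<open>The difference of two candidates lies both in \<open>S\<close> and in its
    orthogonal complement.\<close>
  ultimately have "orthogonal (z - y) (z - y)"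
    by (simp add: orthogonal_comp_def)
  then show "z = y" by (simp add: orthogonal_self)
qed (use y in simp)

lemma orth_proj_works:
  fixes S :: "(real ^ 'n) set"
  assumes "subspace S"
  shows "orth_proj S x \<in> S" "x - orth_proj S x \<in> S\<^sup>\<bottom>"
proof -
  obtain y z where "y \<in> S" "z \<in> S\<^sup>\<bottom>" "x = y + z"
    using subspace_sum_orthogonal_comp[OF assms] set_plus_elim by blast
  then show "orth_proj S x \<in> S" "x - orth_proj S x \<in> S\<^sup>\<bottom>"
    using orth_proj_eqI[OF assms, of y x] by auto
qed

lemma linear_orth_proj:
  fixes S :: "(real ^ 'n) set"
  assumes S: "subspace S"
  shows "linear (orth_proj S)"
proof (rule linearI)
  note works = orth_proj_works[OF S] and comp = subspace_orthogonal_comp[of S]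
  show "orth_proj S (x + y) = orth_proj S x + orth_proj S y" for x y
    using subspace_add[OF S works(1) works(1), of x y] subspace_add[OF comp works(2) works(2), of x y]
    by (intro orth_proj_eqI[OF S]) (auto simp: algebra_simps)
  show "orth_proj S (c *\<^sub>R x) = c *\<^sub>R orth_proj S x" for c x
    using subspace_scale[OF S works(1), of c x] subspace_scale[OF comp works(2), of c x]
    by (intro orth_proj_eqI[OF S]) (auto simp: algebra_simps)
qed

section \<open>Origin-symmetric bodies\<close>

lemma convex_bodies_s_subset_o:
  assumes "K \<in> convex_bodies_s"
  shows "K \<in> convex_bodies_o"
proof -
  obtain y where y: "y \<in> K" and K: "convex K" "K = uminus ` K" "compact K"
    using assms by (auto simp: convex_bodies_s_def)
  have "- y \<in> K" using y K(2) by blast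
  \<comment> \<open>The midpoint of \<open>y\<close> and \<open>- y\<close> is the origin.\<close>
  then have "(1 / 2) *\<^sub>R y + (1 / 2) *\<^sub>R (- y) \<in> K"
    using y by (intro convexD[OF K(1)]) auto
  then show ?thesis using K by (simp add: convex_bodies_o_def)
qed

text \<open>Reflection in the origin is linear and fixes every summand, hence it fixes the
  sum.\<close>

lemma orlicz_sum_in_convex_bodies_s:
  assumes phi: "\<phi> \<in> Orlicz_Phi" and K: "\<And>j. K j \<in> convex_bodies_s"
  shows "orlicz_sum \<phi> K \<in> convex_bodies_s"
proof -
  have o: "K j \<in> convex_bodies_o" for j
    using K by (rule convex_bodies_s_subset_o)
  have "(\<lambda>j. uminus ` K j) = K"
    using K by (auto simp: convex_bodies_s_def fun_eq_iff)
  then have "uminus ` orlicz_sum \<phi> K = orlicz_sum \<phi> K"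
    using orlicz_sum_linear_image[of uminus \<phi> K, OF _ phi o] by (simp add: linear_uminus)
  then show ?thesis
    using orlicz_sum_props[of \<phi> K, OF phi o] by (simp add: convex_bodies_s_def)
qed

theorem theorem5p2:
  fixes \<phi> :: "real ^ 'm \<Rightarrow> real"
  assumes "CARD('m) \<ge> 2" and "CARD('n) \<ge> 2" and "\<phi> \<in> Orlicz_Phi"
  shows
    "(\<forall>K :: 'm \<Rightarrow> (real ^ 'n) set. (\<forall>j. K j \<in> convex_bodies_o) \<longrightarrow>
        (\<exists>!L. is_orlicz_sum \<phi> K L) \<and> orlicz_sum \<phi> K \<in> convex_bodies_o) \<and>
     (\<forall>K L :: 'm \<Rightarrow> (real ^ 'n) set.
        (\<forall>j. K j \<in> convex_bodies_o \<and> L j \<in> convex_bodies_o \<and> K j \<subseteq> L j) \<longrightarrow>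
        orlicz_sum \<phi> K \<subseteq> orlicz_sum \<phi> L) \<and>
     (\<forall>K :: nat \<Rightarrow> 'm \<Rightarrow> (real ^ 'n) set.
        (\<forall>i j. K i j \<in> convex_bodies_o) \<and>
        (\<forall>j. (\<lambda>i. hausdorff_dist (K i j) (K 0 j)) \<longlonglongrightarrow> 0) \<longrightarrow>
        (\<lambda>i. hausdorff_dist (orlicz_sum \<phi> (K i)) (orlicz_sum \<phi> (K 0))) \<longlonglongrightarrow> 0) \<and>
     (\<forall>(A :: real ^ 'n ^ 'n) (K :: 'm \<Rightarrow> (real ^ 'n) set).
        invertible A \<and> (\<forall>j. K j \<in> convex_bodies_o) \<longrightarrow>
        (*v) A ` orlicz_sum \<phi> K = orlicz_sum \<phi> (\<lambda>j. (*v) A ` K j)) \<and>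
     (\<forall>(S :: (real ^ 'n) set) (K :: 'm \<Rightarrow> (real ^ 'n) set).
        subspace S \<and> (\<forall>j. K j \<in> convex_bodies_o) \<longrightarrow>
        orth_proj S ` orlicz_sum \<phi> K = orlicz_sum \<phi> (\<lambda>j. orth_proj S ` K j)) \<and>
     (\<forall>(j :: 'm) (M :: (real ^ 'n) set). M \<in> convex_bodies_o \<longrightarrow>
        orlicz_sum \<phi> (\<lambda>i. if i = j then M else {0}) = M) \<and>
     (\<forall>K :: 'm \<Rightarrow> (real ^ 'n) set. (\<forall>j. K j \<in> convex_bodies_s) \<longrightarrow>
        orlicz_sum \<phi> K \<in> convex_bodies_s)"
proof (intro conjI allI impI)
  note phi = assms(3)
  fix K :: "'m \<Rightarrow> (real ^ 'n) set"
  {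
    assume K: "\<forall>j. K j \<in> convex_bodies_o"
    show "\<exists>!L. is_orlicz_sum \<phi> K L"
      using K by (intro orlicz_sum_exists_unique[OF phi]) simp
    show "orlicz_sum \<phi> K \<in> convex_bodies_o"
      using K by (intro orlicz_sum_in_convex_bodies_o[OF phi]) simp
  }
  show "orlicz_sum \<phi> K \<subseteq> orlicz_sum \<phi> L"
    if "\<forall>j. K j \<in> convex_bodies_o \<and> L j \<in> convex_bodies_o \<and> K j \<subseteq> L j" for L
    using that by (intro orlicz_sum_mono[OF phi]) simp_all
  show "(*v) A ` orlicz_sum \<phi> K = orlicz_sum \<phi> (\<lambda>j. (*v) A ` K j)"
    if "invertible A \<and> (\<forall>j. K j \<in> convex_bodies_o)" for A :: "real ^ 'n ^ 'n"
    using that by (intro orlicz_sum_linear_image phi) simp_all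
  show "orth_proj S ` orlicz_sum \<phi> K = orlicz_sum \<phi> (\<lambda>j. orth_proj S ` K j)"
    if "subspace S \<and> (\<forall>j. K j \<in> convex_bodies_o)" for S
    using that by (intro orlicz_sum_linear_image linear_orth_proj phi) simp_all
  show "orlicz_sum \<phi> K \<in> convex_bodies_s" if "\<forall>j. K j \<in> convex_bodies_s"
    using that by (intro orlicz_sum_in_convex_bodies_s[OF phi]) simp
next
  fix K :: "nat \<Rightarrow> 'm \<Rightarrow> (real ^ 'n) set"
  assume "(\<forall>i j. K i j \<in> convex_bodies_o) \<and>
      (\<forall>j. (\<lambda>i. hausdorff_dist (K i j) (K 0 j)) \<longlonglongrightarrow> 0)"
  \<comment> \<open>The limit tuple \<open>L\<close> is the member of index 0 of the family
    itself.\<close>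
  then show "(\<lambda>i. hausdorff_dist (orlicz_sum \<phi> (K i)) (orlicz_sum \<phi> (K 0))) \<longlonglongrightarrow> 0"
    by (intro orlicz_sum_tendsto[OF assms(3)]) simp_all
next
  fix j :: 'm and M :: "(real ^ 'n) set"
  assume "M \<in> convex_bodies_o"
  then show "orlicz_sum \<phi> (\<lambda>i. if i = j then M else {0}) = M"
    by (rule orlicz_sum_single[OF assms(3)])
qed

end
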